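(* Let $\phi:\mathbb{R}\times\mathbb{R}^n\to\mathbb{R}^m$ be such that $t\mapsto\phi(t,x)$ is locally integrable for each $x$. Then $\phi$ is u$\delta$-PE with respect to $x_1$ if and only if for each $\Delta>0$ there exist $\gamma_\Delta\in\mathcal{K}$ and a continuous strictly decreasing function $\theta_\Delta:\mathbb{R}_{>0}\to\mathbb{R}_{>0}$ such that, for all $t\in\mathbb{R}$, $$|x_1|\in(0,\Delta],\ |x_2|\in[0,\Delta]\quad\Longrightarrow\quad\int_t^{t+\theta_\Delta(|x_1|)}|\phi(\tau,x)|\,d\tau\ge\gamma_\Delta(|x_1|).$$
   Context: $|\cdot|$ is the Euclidean norm. $x\in\mathbb{R}^n$ is partitioned as $x=\mathrm{col}[x_1,x_2]$ with $x_1\in\mathbb{R}^{n_1}$, $x_2\in\mathbb{R}^{n_2}$, and $\mathcal{D}_1:=(\mathbb{R}^{n_1}\setminus\{0\})\times\mathbb{R}^{n_2}$. Class $\mathcal{K}$: continuous strictly increasing $\gamma:\mathbb{R}_{\ge0}\to\mathbb{R}_{\ge0}$ with $\gamma(0)=0$. $\phi$, with $t\mapsto\phi(t,x)$ locally integrable, is u$\delta$-PE (uniformly $\delta$-persistently exciting) with respect to $x_1$ if for each $x\in\mathcal{D}_1$ there exist $\delta>0$, $T>0$, $\mu>0$ such that for all $t\in\mathbb{R}$: $|z-x|\le\delta$ implies $\int_t^{t+T}|\phi(\tau,z)|\,d\tau\ge\mu$. *)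

theory Defs
  imports "HOL-Analysis.Analysis"
begin

definition locally_integrable :: "(real \<Rightarrow> 'a::euclidean_space) \<Rightarrow> bool" where
  "locally_integrable f \<longleftrightarrow> (\<forall>K. compact K \<longrightarrow> f absolutely_integrable_on K)"

text \<open>Class \<open>\<K>\<close>. A function on the nonnegative reals is represented by a total function on
  the reals of which only the restriction to the nonnegative reals matters.\<close>

definition class_K :: "(real \<Rightarrow> real) set" where
  "class_K = {\<gamma>. \<gamma> \<in> {0..} \<rightarrow> {0..} \<and> continuous_on {0..} \<gamma> \<and> strict_mono_on {0..} \<gamma> \<and> \<gamma> 0 = 0}"

text \<open>The state \<open>x = col[x\<^sub>1, x\<^sub>2]\<close> is the pair \<open>(x\<^sub>1, x\<^sub>2)\<close>; the norm of the
  product type is the Euclidean norm of the stacked vector.\<close>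

definition D1 :: "((real ^ 'n1) \<times> (real ^ 'n2)) set" where
  "D1 = (UNIV - {0}) \<times> UNIV"

text \<open>Uniform \<open>\<delta>\<close>-persistency of excitation with respect to the first component. The set
  integral is meaningful only when \<open>\<tau> \<mapsto> \<phi> \<tau> z\<close> is locally integrable for every \<open>z\<close>, a
  standing assumption that is not repeated in the definition.\<close>

definition udelta_PE ::
    "(real \<Rightarrow> (real ^ 'n1) \<times> (real ^ 'n2) \<Rightarrow> real ^ 'm) \<Rightarrow> bool" where
  "udelta_PE \<phi> \<longleftrightarrow>
     (\<forall>x\<in>D1. \<exists>\<delta>>0. \<exists>T>0. \<exists>\<mu>>0. \<forall>t z. norm (z - x) \<le> \<delta> \<longrightarrow>
        (LINT \<tau>:{t..t + T}|lebesgue. norm (\<phi> \<tau> z)) \<ge> \<mu>)"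

end

theory Submission
  imports Defs
begin

text \<open>The excitation integral over \<open>[t, t + K]\<close> grows with \<open>K\<close>, so a window \<open>T\<close> with
  lower bound \<open>\<mu>\<close> may be replaced by one number \<open>K \<ge> max T (1 / \<mu>)\<close> serving as window
  \<open>K\<close> with lower bound \<open>1 / K\<close>, and then by any larger number.

  If \<open>\<phi>\<close> is u\<open>\<delta>\<close>-PE, every point with \<open>x\<^sub>1 \<noteq> 0\<close> has a neighbourhood on which one such
  \<open>K\<close> works. The points with \<open>1 / (n + 1) \<le> |x\<^sub>1| \<le> \<Delta>\<close> and \<open>|x\<^sub>2| \<le> \<Delta>\<close> form a compact set, so
  a single number \<open>K n\<close> works on all of it (\<open>compact_uniform_parameter\<close>). These numbers may jump and
  need not be monotone in \<open>n\<close>, but they lie below a continuous strictly increasing function \<open>g\<close>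
  of \<open>u = 1 / |x\<^sub>1|\<close> (\<open>continuous_strict_mono_majorant\<close>). Then \<open>\<theta> s = g (1 / s)\<close> and
  \<open>\<gamma> s = 1 / g (1 / s)\<close> have the required bounds; making \<open>g u \<ge> u\<close> forces \<open>\<gamma> s \<le> s\<close> and hence
  continuity of \<open>\<gamma>\<close> at 0.

  Conversely, a point \<open>z\<close> within \<open>\<delta> = |x\<^sub>1| / 2\<close> of \<open>x\<close> has \<open>|z\<^sub>1| \<ge> \<delta>\<close>, so by
  monotonicity \<open>T = \<theta> \<delta>\<close> and \<open>\<mu> = \<gamma> \<delta>\<close> work for all those \<open>z\<close>.\<close>

section \<open>Excitation integrals\<close>

lemma locally_integrable_window_mono:
  fixes f :: "real \<Rightarrow> 'a::euclidean_space"
  assumes f: "locally_integrable f" and "T \<le> T'"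
  shows "(LINT \<tau>:{t..t + T}|lebesgue. norm (f \<tau>)) \<le> (LINT \<tau>:{t..t + T'}|lebesgue. norm (f \<tau>))"
proof -
  have int: "set_integrable lebesgue {t..t + S} (\<lambda>\<tau>. norm (f \<tau>))" for S
    using f unfolding locally_integrable_def by (intro set_integrable_norm) simp
  show ?thesis
    unfolding set_lebesgue_integral_def
    using int[of T] int[of T'] \<open>T \<le> T'\<close> unfolding set_integrable_def
    by (intro integral_mono) (auto simp: indicator_def)
qed

section \<open>Uniform parameters on compact sets\<close>

text \<open>A finite subcover leaves finitely many parameters, and because \<open>P\<close> is upward closed in the
  parameter their maximum serves everywhere.\<close>

lemma compact_uniform_parameter:
  fixes P :: "real \<Rightarrow> 'a::metric_space \<Rightarrow> bool"
  assumes "compact C"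
    and local: "\<And>x. x \<in> C \<Longrightarrow> \<exists>\<delta>>0. \<exists>K. \<forall>z\<in>ball x \<delta>. P K z"
    and mono: "\<And>K K' z. P K z \<Longrightarrow> K \<le> K' \<Longrightarrow> P K' z"
  shows "\<exists>K. \<forall>z\<in>C. P K z"
proof -
  obtain \<delta> K where \<delta>: "\<And>x. x \<in> C \<Longrightarrow> \<delta> x > 0"
    and K: "\<And>x z. x \<in> C \<Longrightarrow> z \<in> ball x (\<delta> x) \<Longrightarrow> P (K x) z"
    using local by metis
  obtain F where F: "F \<subseteq> C" "finite F" "C \<subseteq> (\<Union>x\<in>F. ball x (\<delta> x))"
  proof (rule compactE_image[OF \<open>compact C\<close>])
    show "C \<subseteq> (\<Union>x\<in>C. ball x (\<delta> x))" using \<delta> by force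
  qed auto
  have "P (Max (K ` F)) z" if "z \<in> C" for z
  proof -
    obtain x where x: "x \<in> F" "z \<in> ball x (\<delta> x)"
      using F(3) \<open>z \<in> C\<close> by blast
    have "P (K x) z" using x F(1) K by blast
    moreover have "K x \<le> Max (K ` F)" using x(1) F(2) by simp
    ultimately show ?thesis by (rule mono)
  qed
  then show ?thesis by blast
qed

section \<open>Continuous monotone gauges\<close>

text \<open>The majorant is \<open>u\<close> plus a sum of ramps, the \<open>k\<close>-th of which climbs from 0 to \<open>K k\<close>
  on \<open>[k - 1, k]\<close>. On each half-line \<open>{..N}\<close> only finitely many ramps are nonzero, so the sum is
  continuous there.\<close>

lemma continuous_strict_mono_majorant:
  fixes K :: "nat \<Rightarrow> real"
  assumes K: "\<And>n. 0 \<le> K n"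
  obtains g :: "real \<Rightarrow> real"
  where "continuous_on UNIV g" "strict_mono g" "\<And>u. u \<le> g u"
    "\<And>n u. real n \<le> u \<Longrightarrow> K n \<le> g u"
proof -
  define r where "r k u = K k * max 0 (min 1 (u - real k + 1))" for k u
  define g where "g u = u + (\<Sum>k\<le>nat \<lceil>u\<rceil>. r k u)" for u
  have r_mono: "r k u \<le> r k v" if "u \<le> v" for k u v
    unfolding r_def using that K by (intro mult_left_mono) auto
  have r_nonneg: "0 \<le> r k u" for k u
    unfolding r_def using K by simp
  have g_eq: "g u = u + (\<Sum>k\<le>N. r k u)" if "u \<le> real N" for u N
  proof -
    have "(\<Sum>k\<le>N. r k u) = (\<Sum>k\<le>nat \<lceil>u\<rceil>. r k u)"
    proof (rule sum.mono_neutral_right)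
      show "{..nat \<lceil>u\<rceil>} \<subseteq> {..N}" using that by (auto simp: ceiling_le_iff)
      show "\<forall>k\<in>{..N} - {..nat \<lceil>u\<rceil>}. r k u = 0"
      proof
        fix k assume "k \<in> {..N} - {..nat \<lceil>u\<rceil>}"
        then have "nat \<lceil>u\<rceil> < k" by simp
        then have "u - real k + 1 \<le> 0" by linarith
        then show "r k u = 0" unfolding r_def by simp
      qed
    qed simp
    then show ?thesis by (simp add: g_def)
  qed
  show thesis
  proof
    have "isCont g u" for u
    proof -
      obtain N :: nat where N: "u < real N" using reals_Archimedean2 by blast
      have "continuous_on {..<real N} (\<lambda>u. u + (\<Sum>k\<le>N. r k u))"
        unfolding r_def by (intro continuous_intros)
      then have "continuous_on {..<real N} g"
        by (rule continuous_on_eq) (auto simp: g_eq[of _ N])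
      then show ?thesis using N by (simp add: continuous_on_eq_continuous_at)
    qed
    then show "continuous_on UNIV g" by (simp add: continuous_at_imp_continuous_on)
    show "strict_mono g"
    proof (rule strict_monoI)
      fix u v :: real assume "u < v"
      obtain N :: nat where N: "v \<le> real N" using real_arch_simple by blast
      have "(\<Sum>k\<le>N. r k u) \<le> (\<Sum>k\<le>N. r k v)"
        using \<open>u < v\<close> by (intro sum_mono r_mono) simp
      then show "g u < g v" using \<open>u < v\<close> N by (simp add: g_eq[of _ N])
    qed
    show "u \<le> g u" for u
      unfolding g_def by (simp add: sum_nonneg r_nonneg)
    show "K n \<le> g u" if "real n \<le> u" for n u
    proof -
      have "K n = r n u" unfolding r_def using that by simp
      also have "\<dots> \<le> (\<Sum>k\<le>nat \<lceil>u\<rceil>. r k u)"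
        using that by (intro member_le_sum) (auto simp: r_nonneg, linarith)
      also have "\<dots> \<le> g u" unfolding g_def using that by simp
      finally show ?thesis .
    qed
  qed
qed

lemma reciprocal_substitution_antimono:
  fixes g :: "real \<Rightarrow> real"
  assumes "continuous_on UNIV g" "strict_mono g" "\<And>u. u \<le> g u"
  defines "\<theta> \<equiv> \<lambda>s. g (1 / s)"
  shows "\<theta> \<in> {0<..} \<rightarrow> {0<..}" "continuous_on {0<..} \<theta>" "strict_antimono_on {0<..} \<theta>"
proof -
  have "0 < \<theta> s" if "s > 0" for s
    using assms(3)[of "1 / s"] that unfolding \<theta>_def
    by (meson less_le_trans zero_less_divide_1_iff)
  then show "\<theta> \<in> {0<..} \<rightarrow> {0<..}" by auto
  show "continuous_on {0<..} \<theta>"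
    unfolding \<theta>_def
    by (rule continuous_on_compose2[OF assms(1)]) (auto intro!: continuous_intros)
  show "strict_antimono_on {0<..} \<theta>"
    unfolding \<theta>_def
    by (intro monotone_onI strict_monoD[OF assms(2)]) (auto simp: field_simps)
qed

text \<open>The pole of \<open>\<theta>\<close> at 0 gives \<open>1 / \<theta> s \<le> s\<close>, which squeezes the
  reciprocal to 0.\<close>

lemma reciprocal_in_class_K:
  assumes \<theta>: "\<theta> \<in> {0<..} \<rightarrow> {0<..}" "continuous_on {0<..} \<theta>" "strict_antimono_on {0<..} \<theta>"
    and pole: "\<And>s. s > 0 \<Longrightarrow> 1 / s \<le> \<theta> s"
  shows "(\<lambda>s. if s = 0 then 0 else 1 / \<theta> s) \<in> class_K" (is "?\<gamma> \<in> _")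
proof -
  have pos: "0 < \<theta> s" if "s > 0" for s using \<theta>(1) that by auto
  have le: "1 / \<theta> s \<le> s" if "s > 0" for s
    using pole[OF that] pos[OF that] that by (simp add: field_simps)
  have "strict_mono_on {0..} ?\<gamma>"
  proof (rule strict_mono_onI)
    fix a b :: real assume ab: "a \<in> {0..}" "b \<in> {0..}" "a < b"
    show "?\<gamma> a < ?\<gamma> b"
    proof (cases "a = 0")
      case True
      then show ?thesis using ab pos[of b] by simp
    next
      case False
      then have "\<theta> b < \<theta> a" using ab by (intro monotone_onD[OF \<theta>(3)]) auto
      then show ?thesis using False ab pos[of b] by (simp add: frac_less2)
    qed
  qed
  moreover have "continuous_on {0..} ?\<gamma>"
  proof (subst continuous_on_eq_continuous_within, intro ballI)
    fix s :: real assume "s \<in> {0..}"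
    then consider "s > 0" | "s = 0" by force
    then show "continuous (at s within {0..}) ?\<gamma>"
    proof cases
      case 1
      have "continuous_on {0<..} (\<lambda>s. 1 / \<theta> s)"
        using pos by (intro continuous_intros \<theta>(2)) (auto simp: less_imp_neq[symmetric])
      then have "continuous_on {0<..} ?\<gamma>"
        by (rule continuous_on_eq) auto
      then have "isCont ?\<gamma> s" using 1 by (simp add: continuous_on_eq_continuous_at)
      then show ?thesis by (rule continuous_at_imp_continuous_at_within)
    next
      case 2
      have "(?\<gamma> \<longlongrightarrow> 0) (at 0 within {0..})"
      proof (rule tendsto_sandwich)
        show "\<forall>\<^sub>F s in at 0 within {0..}. 0 \<le> ?\<gamma> s"
          unfolding eventually_at_filter
          using pos by (intro always_eventually) (auto simp: less_imp_le)
        show "\<forall>\<^sub>F s in at 0 within {0..}. ?\<gamma> s \<le> s"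
          unfolding eventually_at_filter
          using le by (intro always_eventually) auto
      qed (auto intro!: tendsto_eq_intros)
      then show ?thesis using 2 by (simp add: continuous_within)
    qed
  qed
  ultimately show ?thesis
    unfolding class_K_def using pos by (auto simp: less_imp_le)
qed

section \<open>The two directions of the characterization\<close>

lemma udelta_PE_imp_class_K_bound:
  fixes \<phi> :: "real \<Rightarrow> (real ^ 'n1) \<times> (real ^ 'n2) \<Rightarrow> real ^ 'm"
  assumes int: "\<And>x. locally_integrable (\<lambda>t. \<phi> t x)" and PE: "udelta_PE \<phi>"
  shows "\<exists>\<gamma>\<in>class_K. \<exists>\<theta> :: real \<Rightarrow> real.
       \<theta> \<in> {0<..} \<rightarrow> {0<..} \<and> continuous_on {0<..} \<theta> \<and> strict_antimono_on {0<..} \<theta> \<and>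
       (\<forall>t x1 x2. norm x1 \<in> {0<..\<Delta>} \<and> norm x2 \<in> {0..\<Delta>} \<longrightarrow>
          (LINT \<tau>:{t..t + \<theta> (norm x1)}|lebesgue. norm (\<phi> \<tau> (x1, x2))) \<ge> \<gamma> (norm x1))"
proof -
  define P where "P K z \<longleftrightarrow> 0 < K \<and>
    (\<forall>t. (LINT \<tau>:{t..t + K}|lebesgue. norm (\<phi> \<tau> z)) \<ge> 1 / K)" for K z
  have mono: "P K' z" if "P K z" "K \<le> K'" for K K' z
  proof -
    have "1 / K' \<le> 1 / K" using that by (auto simp: P_def intro: frac_le)
    then show ?thesis
      using that locally_integrable_window_mono[OF int \<open>K \<le> K'\<close>]
      unfolding P_def by (meson less_le_trans order_trans)
  qed
  have local: "\<exists>\<delta>>0. \<exists>K. \<forall>z\<in>ball x \<delta>. P K z" if "x \<in> D1" for x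
  proof -
    obtain \<delta> T \<mu> where pos: "\<delta> > 0" "T > 0" "\<mu> > 0"
      and ge: "\<And>t z. norm (z - x) \<le> \<delta> \<Longrightarrow> (LINT \<tau>:{t..t + T}|lebesgue. norm (\<phi> \<tau> z)) \<ge> \<mu>"
      using PE \<open>x \<in> D1\<close> unfolding udelta_PE_def by metis
    define K where "K = max T (1 / \<mu>)"
    have K: "T \<le> K" "0 < K" using pos by (auto simp: K_def)
    have "1 / \<mu> \<le> K" by (simp add: K_def)
    then have "1 / K \<le> \<mu>" using pos K by (simp add: field_simps)
    moreover have "norm (z - x) \<le> \<delta>" if "z \<in> ball x \<delta>" for z
      using that by (simp add: dist_norm norm_minus_commute)
    ultimately have "\<forall>z\<in>ball x \<delta>. P K z"
      unfolding P_def using ge locally_integrable_window_mono[OF int K(1)] K(2)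
      by (meson order_trans)
    then show ?thesis using pos by blast
  qed
  define C :: "nat \<Rightarrow> ((real ^ 'n1) \<times> (real ^ 'n2)) set"
    where "C n = (cball 0 \<Delta> \<times> cball 0 \<Delta>) \<inter> {x. 1 / real (Suc n) \<le> norm (fst x)}" for n
  have "\<exists>K. \<forall>z\<in>C n. P K z" for n
  proof (rule compact_uniform_parameter)
    show "compact (C n)"
      unfolding C_def
      by (intro compact_Int_closed compact_Times compact_cball closed_Collect_le continuous_intros)
    show "\<exists>\<delta>>0. \<exists>K. \<forall>z\<in>ball x \<delta>. P K z" if "x \<in> C n" for x
    proof (rule local)
      have "fst x \<noteq> 0" using that by (auto simp: C_def)
      then show "x \<in> D1" by (auto simp: D1_def mem_Times_iff)
    qed
  qed (rule mono)
  then obtain K where K: "\<And>n z. z \<in> C n \<Longrightarrow> P (K n) z" by metis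
  \<comment> \<open>The absolute value is there because \<open>C n\<close> is empty when \<open>\<Delta> < 1 / (n + 1)\<close>, and
    \<open>K n\<close> may then be negative.\<close>
  obtain g where g: "continuous_on UNIV g" "strict_mono g" "\<And>u. u \<le> g u"
    and gK: "\<And>n u. real n \<le> u \<Longrightarrow> \<bar>K n\<bar> \<le> g u"
    using continuous_strict_mono_majorant[of "\<lambda>n. \<bar>K n\<bar>"] by auto
  define \<theta> where "\<theta> s = g (1 / s)" for s
  note \<theta> = reciprocal_substitution_antimono[OF g, folded \<theta>_def]
  have "(\<lambda>s. if s = 0 then 0 else 1 / \<theta> s) \<in> class_K"
    using \<theta> g(3) by (intro reciprocal_in_class_K) (auto simp: \<theta>_def)
  moreover have "1 / \<theta> (norm x1) \<le> (LINT \<tau>:{t..t + \<theta> (norm x1)}|lebesgue. norm (\<phi> \<tau> (x1, x2)))"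
    if "norm x1 \<in> {0<..\<Delta>}" "norm x2 \<in> {0..\<Delta>}" for t x1 x2
  proof -
    define n where "n = nat \<lfloor>1 / norm x1\<rfloor>"
    have s: "0 < norm x1" using that by simp
    then have "0 \<le> 1 / norm x1" by simp
    then have n: "real n \<le> 1 / norm x1" "1 / norm x1 \<le> real (Suc n)"
      unfolding n_def by linarith+
    then have "1 / real (Suc n) \<le> norm x1" using s by (simp add: field_simps)
    then have "(x1, x2) \<in> C n" using that by (simp add: C_def)
    then have "P (K n) (x1, x2)" by (rule K)
    moreover have "K n \<le> \<theta> (norm x1)" using gK[OF n(1)] by (simp add: \<theta>_def)
    ultimately show ?thesis using mono P_def by blast
  qed
  ultimately show ?thesis
    using \<theta> by (intro bexI[of _ "\<lambda>s. if s = 0 then 0 else 1 / \<theta> s"] exI[of _ \<theta>]) auto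
qed

lemma class_K_bound_imp_udelta_PE:
  fixes \<phi> :: "real \<Rightarrow> (real ^ 'n1) \<times> (real ^ 'n2) \<Rightarrow> real ^ 'm"
  assumes int: "\<And>x. locally_integrable (\<lambda>t. \<phi> t x)"
    and bound: "\<forall>\<Delta>>0. \<exists>\<gamma>\<in>class_K. \<exists>\<theta> :: real \<Rightarrow> real.
       \<theta> \<in> {0<..} \<rightarrow> {0<..} \<and> continuous_on {0<..} \<theta> \<and> strict_antimono_on {0<..} \<theta> \<and>
       (\<forall>t x1 x2. norm x1 \<in> {0<..\<Delta>} \<and> norm x2 \<in> {0..\<Delta>} \<longrightarrow>
          (LINT \<tau>:{t..t + \<theta> (norm x1)}|lebesgue. norm (\<phi> \<tau> (x1, x2))) \<ge> \<gamma> (norm x1))"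
  shows "udelta_PE \<phi>"
  unfolding udelta_PE_def
proof
  fix x :: "(real ^ 'n1) \<times> (real ^ 'n2)" assume "x \<in> D1"
  then have x1: "fst x \<noteq> 0" by (auto simp: D1_def)
  define \<delta> where "\<delta> = norm (fst x) / 2"
  have \<delta>: "\<delta> > 0" using x1 by (simp add: \<delta>_def)
  define \<Delta> where "\<Delta> = norm x + \<delta>"
  have "\<Delta> > 0" using \<delta> by (simp add: \<Delta>_def add_nonneg_pos)
  then obtain \<gamma> \<theta> where \<gamma>: "\<gamma> \<in> class_K" and \<theta>: "\<theta> \<in> {0<..} \<rightarrow> {0<..}"
    "strict_antimono_on {0<..} \<theta>"
    and ge: "\<forall>t x1 x2. norm x1 \<in> {0<..\<Delta>} \<and> norm x2 \<in> {0..\<Delta>} \<longrightarrow>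
      (LINT \<tau>:{t..t + \<theta> (norm x1)}|lebesgue. norm (\<phi> \<tau> (x1, x2))) \<ge> \<gamma> (norm x1)"
    using bound by blast
  have \<gamma>_mono: "strict_mono_on {0..} \<gamma>" and \<gamma>_0: "\<gamma> 0 = 0"
    using \<gamma> by (auto simp: class_K_def)
  have "\<theta> \<delta> > 0" using \<theta>(1) \<delta> by auto
  moreover have "\<gamma> \<delta> > 0" using strict_mono_onD[OF \<gamma>_mono, of 0 \<delta>] \<delta> \<gamma>_0 by simp
  moreover have "(LINT \<tau>:{t..t + \<theta> \<delta>}|lebesgue. norm (\<phi> \<tau> z)) \<ge> \<gamma> \<delta>"
    if "norm (z - x) \<le> \<delta>" for t z
  proof -
    have "norm (fst z - fst x) \<le> \<delta>"
      using that by (metis fst_diff norm_fst_le order_trans prod.collapse)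
    then have z1: "\<delta> \<le> norm (fst z)"
      using norm_triangle_ineq2[of "fst x" "fst z"] by (simp add: \<delta>_def norm_minus_commute)
    then have z0: "fst z \<noteq> 0" using \<delta> by auto
    have z: "norm z \<le> \<Delta>"
      using norm_triangle_ineq2[of z x] that by (simp add: \<Delta>_def)
    have "norm (fst z) \<le> \<Delta>" "norm (snd z) \<le> \<Delta>"
      using norm_fst_le[of "fst z" "snd z"] norm_snd_le[of "snd z" "fst z"] z by simp_all
    then have "\<gamma> (norm (fst z)) \<le> (LINT \<tau>:{t..t + \<theta> (norm (fst z))}|lebesgue. norm (\<phi> \<tau> z))"
      using ge[rule_format, of "fst z" "snd z" t] z0 by simp
    also have "\<dots> \<le> (LINT \<tau>:{t..t + \<theta> \<delta>}|lebesgue. norm (\<phi> \<tau> z))"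
    proof (rule locally_integrable_window_mono[OF int])
      show "\<theta> (norm (fst z)) \<le> \<theta> \<delta>"
        using monotone_onD[OF \<theta>(2), of \<delta> "norm (fst z)"] z0 z1 \<delta>
        by (cases "\<delta> = norm (fst z)") auto
    qed
    finally show ?thesis
      using strict_mono_onD[OF \<gamma>_mono, of \<delta> "norm (fst z)"] z1 \<delta>
      by (cases "\<delta> = norm (fst z)") auto
  qed
  ultimately show "\<exists>\<delta>>0. \<exists>T>0. \<exists>\<mu>>0. \<forall>t z. norm (z - x) \<le> \<delta> \<longrightarrow>
      (LINT \<tau>:{t..t + T}|lebesgue. norm (\<phi> \<tau> z)) \<ge> \<mu>"
    using \<delta> by blast
qed

theorem lemma3:
  fixes \<phi> :: "real \<Rightarrow> (real ^ 'n1) \<times> (real ^ 'n2) \<Rightarrow> real ^ 'm"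
  assumes "\<And>x. locally_integrable (\<lambda>t. \<phi> t x)"
  shows "udelta_PE \<phi> \<longleftrightarrow>
    (\<forall>\<Delta>>0. \<exists>\<gamma>\<in>class_K. \<exists>\<theta> :: real \<Rightarrow> real.
       \<theta> \<in> {0<..} \<rightarrow> {0<..} \<and> continuous_on {0<..} \<theta> \<and> strict_antimono_on {0<..} \<theta> \<and>
       (\<forall>t x1 x2. norm x1 \<in> {0<..\<Delta>} \<and> norm x2 \<in> {0..\<Delta>} \<longrightarrow>
          (LINT \<tau>:{t..t + \<theta> (norm x1)}|lebesgue. norm (\<phi> \<tau> (x1, x2))) \<ge> \<gamma> (norm x1)))"
  using udelta_PE_imp_class_K_bound[of \<phi>, OF assms] class_K_bound_imp_udelta_PE[of \<phi>, OF assms]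
  by blast

end
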